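(* Consider the decomposed system and the DD-LSPG reduced-order model described in the context, in either the interior/boundary-bases case (with trial subspace $\mathcal S=\mathcal S_{\text{I/B}}$) or the full-subdomain-bases case (with trial subspace $\mathcal S=\mathcal S_{\text F}$). Assume: (A1) strong constraints are employed, i.e. $\boldsymbol A_i=\bar{\boldsymbol A}_i$ for $i=1,\dots,n_\Omega$; (A2) there exists $\kappa_\ell>0$ such that for all $\boldsymbol w,\boldsymbol y\in\mathbb R^n$ $$\Big(\sum_{i=1}^{n_\Omega}\|\boldsymbol r_i(\boldsymbol P_i^\Omega\boldsymbol w,\boldsymbol P_i^\Gamma\boldsymbol w)-\boldsymbol r_i(\boldsymbol P_i^\Omega\boldsymbol y,\boldsymbol P_i^\Gamma\boldsymbol y)\|_2^2\Big)^{1/2}\ \ge\ \kappa_\ell\,\|\boldsymbol w-\boldsymbol y\|_2;$$ (A3) there exists $P>0$ such that for all $\boldsymbol w\in\mathcal S$ $$\Big(\sum_{i=1}^{n_\Omega}\|\boldsymbol B_i\boldsymbol r_i(\boldsymbol P_i^\Omega\boldsymbol w,\boldsymbol P_i^\Gamma\boldsymbol w)\|_2^2\Big)^{1/2}\ \ge\ P\,\Big(\sum_{i=1}^{n_\Omega}\|\boldsymbol r_i(\boldsymbol P_i^\Omega\boldsymbol w,\boldsymbol P_i^\Gamma\boldsymbol w)\|_2^2\Big)^{1/2};$$ (A4) there exists $\kappa_u>0$ such that for all $\boldsymbol w,\boldsymbol y\in\mathbb R^n$ $$\Big(\sum_{i=1}^{n_\Omega}\|\boldsymbol B_i\boldsymbol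 r_i(\boldsymbol P_i^\Omega\boldsymbol w,\boldsymbol P_i^\Gamma\boldsymbol w)-\boldsymbol B_i\boldsymbol r_i(\boldsymbol P_i^\Omega\boldsymbol y,\boldsymbol P_i^\Gamma\boldsymbol y)\|_2^2\Big)^{1/2}\ \le\ \kappa_u\,\|\boldsymbol w-\boldsymbol y\|_2.$$ Let $\boldsymbol x\in\mathbb R^n$ be the full-order solution, i.e. $\boldsymbol r(\boldsymbol x)=\boldsymbol 0$, and let $\tilde{\boldsymbol x}\in\mathbb R^n$ be the global DD-LSPG solution. Then, for both types of bases, $$\|\boldsymbol x-\tilde{\boldsymbol x}\|_2\ \le\ \frac{\kappa_u}{P\,\kappa_\ell}\ \min_{\boldsymbol w\in\mathcal S}\|\boldsymbol x-\boldsymbol w\|_2 .$$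
   Context: Full-order model and algebraic decomposition. $\boldsymbol r:\mathbb R^n\to\mathbb R^n$ is a (nonlinear) residual with $$\boldsymbol r(\boldsymbol w)=\sum_{i=1}^{n_\Omega}[\boldsymbol P_i^{r}]^T\boldsymbol r_i(\boldsymbol P_i^\Omega\boldsymbol w,\boldsymbol P_i^\Gamma\boldsymbol w)\quad\text{for all }\boldsymbol w\in\mathbb R^n,$$ where $\boldsymbol r_i:\mathbb R^{n_i^\Omega}\times\mathbb R^{n_i^\Gamma}\to\mathbb R^{n_i^r}$ are subdomain residuals and $\boldsymbol P_i^r\in\{0,1\}^{n_i^r\times n}$, $\boldsymbol P_i^\Omega\in\{0,1\}^{n_i^\Omega\times n}$, $\boldsymbol P_i^\Gamma\in\{0,1\}^{n_i^\Gamma\times n}$ are sampling matrices (each consists of distinct selected rows of the $n\times n$ identity) extracting residual entries, interior states and interface states of subdomain $i$. They satisfy $\boldsymbol P_i^r[\boldsymbol P_j^r]^T=\boldsymbol 0$ and $\boldsymbol P_i^\Omega[\boldsymbol P_j^\Omega]^T=\boldsymbol 0$ for $i\ne j$, and $\sum_i n_i^r=n$. Put $n_i=n_i^\Omega+n_i^\Gamma$. Ports. There are $n_p$ ports. Port $j$ is a group of $n_j^p$ global degrees of freedom shared by a fixed set of subdomains $\mathcal P(j)\subseteq\{1,\dots,n_\Omega\}$. For $i\in\mathcal P(j)$, $\boldsymbol P_i^j\in\{0,1\}^{n_j^p\times n_i^\Gamma}$ consists of selected rows of the $n_i^\Gamma\times n_i^\Gamma$ identity and extracts the degrees of freedom of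 port $j$ from the interface state of subdomain $i$. $\boldsymbol P^j\in\{0,1\}^{n_j^p\times n}$ consists of selected rows of the $n\times n$ identity and extracts from the global state the degrees of freedom of port $j$; thus $\boldsymbol P_i^j\boldsymbol P_i^\Gamma=\boldsymbol P^j$ for every $i\in\mathcal P(j)$. For each subdomain $i$, with $\mathcal Q(i)=\{j: i\in\mathcal P(j)\}$, the ports are non-overlapping, $\boldsymbol P_i^j[\boldsymbol P_i^\ell]^T=\boldsymbol 0$ for $j\neq\ell$ in $\mathcal Q(i)$, and $\sum_{j\in\mathcal Q(i)}n_j^p=n_i^\Gamma$. The global degrees of freedom $\{1,\dots,n\}$ are partitioned into segments: one for the interior degrees of freedom of each subdomain and one for each port. Strong compatibility constraints. $\bar{\boldsymbol A}_i\in\{-1,0,1\}^{n_{\bar A}\times n_i^\Gamma}$, $i=1,\dots,n_\Omega$, with $n_{\bar A}=\sum_j(|\mathcal P(j)|-1)n_j^p$, are matrices assembled so that $\sum_i\bar{\boldsymbol A}_i\boldsymbol y_i=\boldsymbol 0$ (with $\boldsymbol y_i\in\mathbb R^{n_i^\Gamma}$) holds if and only if $\boldsymbol P_i^j\boldsymbol y_i=\boldsymbol P_\ell^j\boldsymbol y_\ell$ for all $i,\ell\in\mathcal P(j)$ and all $j$. Bases. Interior/boundary-bases case: full-column-rank matrices $\boldsymbol\Phi_i^\Omega\in\mathbb R^{n_i^\Omega\times p_i^\Omega}$ and $\boldsymbol\Phi_i^\Gamma\in\mathbb R^{n_i^\Gamma\times p_i^\Gamma}$ are given. Full-subdomain-bases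 case: a full-column-rank matrix $\boldsymbol\Phi_i\in\mathbb R^{n_i\times p_i}$ is given for each $i$, and $\boldsymbol\Phi_i^\Omega\in\mathbb R^{n_i^\Omega\times p_i}$, $\boldsymbol\Phi_i^\Gamma\in\mathbb R^{n_i^\Gamma\times p_i}$ are its blocks of rows corresponding to interior and interface degrees of freedom ($p_i^\Omega=p_i^\Gamma=p_i$; these blocks need not have full column rank individually). DD-LSPG reduced-order model. Given matrices $\boldsymbol B_i\in\mathbb R^{n_i^B\times n_i^r}$ with $n_i^B\le n_i^r$ and constraint matrices $\boldsymbol A_i\in\mathbb R^{n_A\times n_i^\Gamma}$: - interior/boundary bases: $(\hat{\boldsymbol x}_i^\Omega,\hat{\boldsymbol x}_i^\Gamma)_{i}$ is a solution of: minimize $\frac12\sum_i\|\boldsymbol B_i\boldsymbol r_i(\boldsymbol\Phi_i^\Omega\hat{\boldsymbol w}_i^\Omega,\boldsymbol\Phi_i^\Gamma\hat{\boldsymbol w}_i^\Gamma)\|_2^2$ over $(\hat{\boldsymbol w}_i^\Omega,\hat{\boldsymbol w}_i^\Gamma)_i$ subject to $\sum_i\boldsymbol A_i\boldsymbol\Phi_i^\Gamma\hat{\boldsymbol w}_i^\Gamma=\boldsymbol 0$; one sets $\tilde{\boldsymbol x}_i^\Omega=\boldsymbol\Phi_i^\Omega\hat{\boldsymbol x}_i^\Omega$, $\tilde{\boldsymbol x}_i^\Gamma=\boldsymbol\Phi_i^\Gamma\hat{\boldsymbol x}_i^\Gamma$; - full-subdomain bases: $(\hat{\boldsymbol x}_i)_i$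 is a solution of: minimize $\frac12\sum_i\|\boldsymbol B_i\boldsymbol r_i(\boldsymbol\Phi_i^\Omega\hat{\boldsymbol w}_i,\boldsymbol\Phi_i^\Gamma\hat{\boldsymbol w}_i)\|_2^2$ over $(\hat{\boldsymbol w}_i)_i$ subject to $\sum_i\boldsymbol A_i\boldsymbol\Phi_i^\Gamma\hat{\boldsymbol w}_i=\boldsymbol 0$; one sets $\tilde{\boldsymbol x}_i^\Omega=\boldsymbol\Phi_i^\Omega\hat{\boldsymbol x}_i$, $\tilde{\boldsymbol x}_i^\Gamma=\boldsymbol\Phi_i^\Gamma\hat{\boldsymbol x}_i$. When $\boldsymbol A_i=\bar{\boldsymbol A}_i$ for all $i$, the subdomain solutions agree on ports, and the global DD-LSPG solution is the vector $\tilde{\boldsymbol x}\in\mathbb R^n$ with $\boldsymbol P_i^\Omega\tilde{\boldsymbol x}=\tilde{\boldsymbol x}_i^\Omega$ and $\boldsymbol P_i^\Gamma\tilde{\boldsymbol x}=\tilde{\boldsymbol x}_i^\Gamma$ for all $i$. Trial subspaces. Let $\bar{\boldsymbol A}=[\bar{\boldsymbol A}_1\boldsymbol\Phi_1^\Gamma\ \cdots\ \bar{\boldsymbol A}_{n_\Omega}\boldsymbol\Phi_{n_\Omega}^\Gamma]$, $p^{\text{null}}=\sum_ip_i^\Gamma-\operatorname{rank}(\bar{\boldsymbol A})$, and let $\bar{\boldsymbol N}\in\mathbb R^{(\sum_ip_i^\Gamma)\times p^{\text{null}}}$ be a matrix whose columns form a basis of the null space of $\bar{\boldsymbol A}$,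 with $i$th row block $\bar{\boldsymbol N}_i\in\mathbb R^{p_i^\Gamma\times p^{\text{null}}}$. In the interior/boundary-bases case, $$\mathcal S_{\text{I/B}}=\{\boldsymbol w\in\mathbb R^n:\ \exists\,\hat{\boldsymbol w}_i^\Omega\in\mathbb R^{p_i^\Omega}\ (i=1,\dots,n_\Omega),\ \hat{\boldsymbol w}^{\text{null}}\in\mathbb R^{p^{\text{null}}}\text{ with }\boldsymbol P_i^\Omega\boldsymbol w=\boldsymbol\Phi_i^\Omega\hat{\boldsymbol w}_i^\Omega,\ \boldsymbol P_i^\Gamma\boldsymbol w=\boldsymbol\Phi_i^\Gamma\bar{\boldsymbol N}_i\hat{\boldsymbol w}^{\text{null}}\ \forall i\},$$ and in the full-subdomain-bases case, $$\mathcal S_{\text F}=\{\boldsymbol w\in\mathbb R^n:\ \exists\,\hat{\boldsymbol w}^{\text{null}}\in\mathbb R^{p^{\text{null}}}\text{ with }\boldsymbol P_i^\Omega\boldsymbol w=\boldsymbol\Phi_i^\Omega\bar{\boldsymbol N}_i\hat{\boldsymbol w}^{\text{null}},\ \boldsymbol P_i^\Gamma\boldsymbol w=\boldsymbol\Phi_i^\Gamma\bar{\boldsymbol N}_i\hat{\boldsymbol w}^{\text{null}}\ \forall i\}.$$ *)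

theory Defs
  imports
    "HOL-Analysis.L2_Norm"
    "HOL-Library.Disjoint_Sets"
    "Jordan_Normal_Form.Matrix_Kernel"
    "Jordan_Normal_Form.DL_Rank"
begin

text \<open>Vectors and matrices are those of \<open>Jordan_Normal_Form\<close>, since the dimensions vary with the
  subdomain and the port. All indices (degrees of freedom, subdomains, ports) start at 0.\<close>

definition norm2 :: "real vec \<Rightarrow> real" where
  "norm2 v = L2_set (\<lambda>k. v $ k) {..<dim_vec v}"

definition sampling_mat :: "nat \<Rightarrow> nat \<Rightarrow> real mat \<Rightarrow> bool" where
  "sampling_mat m n P \<longleftrightarrow> P \<in> carrier_mat m n \<and>
     (\<exists>f. inj_on f {..<m} \<and> f ` {..<m} \<subseteq> {..<n} \<and> (\<forall>k<m. row P k = row (1\<^sub>m n) (f k)))"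

definition sampled :: "real mat \<Rightarrow> nat set" where
  "sampled P = {c. c < dim_col P \<and> (\<exists>k<dim_row P. P $$ (k, c) = 1)}"

text \<open>The fields \<open>P_port_loc i j\<close> and \<open>P_port j\<close> are the matrices extracting the degrees of freedom
  of port \<open>j\<close> from the interface state of subdomain \<open>i\<close> and from the global state;
  \<open>P_port_loc i j\<close> is meaningful only for \<open>i \<in> port_subs j\<close>.\<close>

record dd_system =
  n_dof :: nat
  n_sub :: nat
  n_int :: "nat \<Rightarrow> nat"
  n_ifc :: "nat \<Rightarrow> nat"
  n_res :: "nat \<Rightarrow> nat"
  P_int :: "nat \<Rightarrow> real mat"
  P_ifc :: "nat \<Rightarrow> real mat"
  P_res :: "nat \<Rightarrow> real mat"
  r_loc :: "nat \<Rightarrow> real vec \<Rightarrow> real vec \<Rightarrow> real vec"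
  r_glob :: "real vec \<Rightarrow> real vec"
  n_port :: nat
  port_dim :: "nat \<Rightarrow> nat"
  port_subs :: "nat \<Rightarrow> nat set"
  P_port_loc :: "nat \<Rightarrow> nat \<Rightarrow> real mat"
  P_port :: "nat \<Rightarrow> real mat"

definition sub_res :: "dd_system \<Rightarrow> nat \<Rightarrow> real vec \<Rightarrow> real vec" where
  "sub_res D i w = r_loc D i (P_int D i *\<^sub>v w) (P_ifc D i *\<^sub>v w)"

definition sub_ports :: "dd_system \<Rightarrow> nat \<Rightarrow> nat set" where
  "sub_ports D i = {j. j < n_port D \<and> i \<in> port_subs D j}"

locale decomposed_system =
  fixes D :: dd_system
  assumes P_int: "\<And>i. i < n_sub D \<Longrightarrow> sampling_mat (n_int D i) (n_dof D) (P_int D i)"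
    and P_ifc: "\<And>i. i < n_sub D \<Longrightarrow> sampling_mat (n_ifc D i) (n_dof D) (P_ifc D i)"
    and P_res: "\<And>i. i < n_sub D \<Longrightarrow> sampling_mat (n_res D i) (n_dof D) (P_res D i)"
    and P_res_orth: "\<And>i j. i < n_sub D \<Longrightarrow> j < n_sub D \<Longrightarrow> i \<noteq> j \<Longrightarrow>
          P_res D i * transpose_mat (P_res D j) = 0\<^sub>m (n_res D i) (n_res D j)"
    and P_int_orth: "\<And>i j. i < n_sub D \<Longrightarrow> j < n_sub D \<Longrightarrow> i \<noteq> j \<Longrightarrow>
          P_int D i * transpose_mat (P_int D j) = 0\<^sub>m (n_int D i) (n_int D j)"
    and sum_n_res: "(\<Sum>i<n_sub D. n_res D i) = n_dof D"
    and r_loc: "\<And>i u v. i < n_sub D \<Longrightarrow> u \<in> carrier_vec (n_int D i) \<Longrightarrow>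
          v \<in> carrier_vec (n_ifc D i) \<Longrightarrow> r_loc D i u v \<in> carrier_vec (n_res D i)"
    and r_glob: "\<And>w. w \<in> carrier_vec (n_dof D) \<Longrightarrow>
          r_glob D w = finsum_vec TYPE(real) (n_dof D)
            (\<lambda>i. transpose_mat (P_res D i) *\<^sub>v sub_res D i w) {..<n_sub D}"
    and port_subs: "\<And>j. j < n_port D \<Longrightarrow> port_subs D j \<subseteq> {..<n_sub D}"
    and P_port_loc: "\<And>i j. j < n_port D \<Longrightarrow> i \<in> port_subs D j \<Longrightarrow>
          sampling_mat (port_dim D j) (n_ifc D i) (P_port_loc D i j)"
    and P_port: "\<And>j. j < n_port D \<Longrightarrow> sampling_mat (port_dim D j) (n_dof D) (P_port D j)"
    and P_port_loc_ifc: "\<And>i j. j < n_port D \<Longrightarrow> i \<in> port_subs D j \<Longrightarrow>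
          P_port_loc D i j * P_ifc D i = P_port D j"
    and P_port_loc_orth: "\<And>i j l. i < n_sub D \<Longrightarrow> j \<in> sub_ports D i \<Longrightarrow> l \<in> sub_ports D i \<Longrightarrow> j \<noteq> l \<Longrightarrow>
          P_port_loc D i j * transpose_mat (P_port_loc D i l) = 0\<^sub>m (port_dim D j) (port_dim D l)"
    and sum_port_dim: "\<And>i. i < n_sub D \<Longrightarrow> (\<Sum>j\<in>sub_ports D i. port_dim D j) = n_ifc D i"
    and segments_disjoint: "disjoint_family_on
          (case_sum (\<lambda>i. sampled (P_int D i)) (\<lambda>j. sampled (P_port D j))) ({..<n_sub D} <+> {..<n_port D})"
    and segments_cover:
          "(\<Union>i<n_sub D. sampled (P_int D i)) \<union> (\<Union>j<n_port D. sampled (P_port D j)) = {..<n_dof D}"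

text \<open>The number of rows is compared in \<open>int\<close>, so that a port without subdomains is not silently
  affected by truncated subtraction.\<close>

definition strong_constraints :: "dd_system \<Rightarrow> nat \<Rightarrow> (nat \<Rightarrow> real mat) \<Rightarrow> bool" where
  "strong_constraints D m Abar \<longleftrightarrow>
     int m = (\<Sum>j<n_port D. (int (card (port_subs D j)) - 1) * int (port_dim D j)) \<and>
     (\<forall>i<n_sub D. Abar i \<in> carrier_mat m (n_ifc D i) \<and> elements_mat (Abar i) \<subseteq> {-1, 0, 1}) \<and>
     (\<forall>y. (\<forall>i<n_sub D. y i \<in> carrier_vec (n_ifc D i)) \<longrightarrow>
        (finsum_vec TYPE(real) m (\<lambda>i. Abar i *\<^sub>v y i) {..<n_sub D} = 0\<^sub>v m \<longleftrightarrow>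
         (\<forall>j<n_port D. \<forall>i\<in>port_subs D j. \<forall>l\<in>port_subs D j.
            P_port_loc D i j *\<^sub>v y i = P_port_loc D l j *\<^sub>v y l)))"

text \<open>Either \<open>p\<^sup>\<Omega>, p\<^sup>\<Gamma>, \<Phi>\<^sup>\<Omega>, \<Phi>\<^sup>\<Gamma>\<close> or \<open>p, \<Phi>\<close>, each indexed by the subdomain. The rows of a full-subdomain
  basis are ordered with the interior degrees of freedom before the interface ones.\<close>

datatype rom_bases =
    Interior_Boundary "nat \<Rightarrow> nat" "nat \<Rightarrow> nat" "nat \<Rightarrow> real mat" "nat \<Rightarrow> real mat"
  | Full_Subdomain "nat \<Rightarrow> nat" "nat \<Rightarrow> real mat"

fun p_ifc :: "rom_bases \<Rightarrow> nat \<Rightarrow> nat" where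
  "p_ifc (Interior_Boundary pO pG PhiO PhiG) i = pG i"
| "p_ifc (Full_Subdomain p Phi) i = p i"

fun Phi_int :: "dd_system \<Rightarrow> rom_bases \<Rightarrow> nat \<Rightarrow> real mat" where
  "Phi_int D (Interior_Boundary pO pG PhiO PhiG) i = PhiO i"
| "Phi_int D (Full_Subdomain p Phi) i = mat (n_int D i) (p i) (\<lambda>(a, b). Phi i $$ (a, b))"

fun Phi_ifc :: "dd_system \<Rightarrow> rom_bases \<Rightarrow> nat \<Rightarrow> real mat" where
  "Phi_ifc D (Interior_Boundary pO pG PhiO PhiG) i = PhiG i"
| "Phi_ifc D (Full_Subdomain p Phi) i = mat (n_ifc D i) (p i) (\<lambda>(a, b). Phi i $$ (n_int D i + a, b))"

definition full_column_rank :: "nat \<Rightarrow> nat \<Rightarrow> real mat \<Rightarrow> bool" where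
  "full_column_rank m p M \<longleftrightarrow> M \<in> carrier_mat m p \<and> vec_space.rank m M = p"

fun valid_bases :: "dd_system \<Rightarrow> rom_bases \<Rightarrow> bool" where
  "valid_bases D (Interior_Boundary pO pG PhiO PhiG) \<longleftrightarrow>
     (\<forall>i<n_sub D. full_column_rank (n_int D i) (pO i) (PhiO i) \<and>
                  full_column_rank (n_ifc D i) (pG i) (PhiG i))"
| "valid_bases D (Full_Subdomain p Phi) \<longleftrightarrow>
     (\<forall>i<n_sub D. full_column_rank (n_int D i + n_ifc D i) (p i) (Phi i))"

text \<open>The objective is a function of the subdomain states \<open>u i, v i\<close>.\<close>

definition lspg_objective ::
  "dd_system \<Rightarrow> (nat \<Rightarrow> real mat) \<Rightarrow> (nat \<Rightarrow> real vec) \<Rightarrow> (nat \<Rightarrow> real vec) \<Rightarrow> real" where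
  "lspg_objective D B u v = 1 / 2 * (\<Sum>i<n_sub D. (norm2 (B i *\<^sub>v r_loc D i (u i) (v i)))\<^sup>2)"

text \<open>\<open>m\<close> is the number of rows of the constraint matrices \<open>A i\<close>.\<close>

definition ib_lspg_solution ::
  "dd_system \<Rightarrow> (nat \<Rightarrow> real mat) \<Rightarrow> nat \<Rightarrow> (nat \<Rightarrow> real mat) \<Rightarrow> (nat \<Rightarrow> nat) \<Rightarrow> (nat \<Rightarrow> nat) \<Rightarrow>
   (nat \<Rightarrow> real mat) \<Rightarrow> (nat \<Rightarrow> real mat) \<Rightarrow> (nat \<Rightarrow> real vec) \<Rightarrow> (nat \<Rightarrow> real vec) \<Rightarrow> bool" where
  "ib_lspg_solution D B m A pO pG PhiO PhiG xO xG \<longleftrightarrow>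
     is_arg_min
       (\<lambda>(wO, wG). lspg_objective D B (\<lambda>i. PhiO i *\<^sub>v wO i) (\<lambda>i. PhiG i *\<^sub>v wG i))
       (\<lambda>(wO, wG).
          (\<forall>i<n_sub D. wO i \<in> carrier_vec (pO i) \<and> wG i \<in> carrier_vec (pG i)) \<and>
          finsum_vec TYPE(real) m (\<lambda>i. A i *\<^sub>v (PhiG i *\<^sub>v wG i)) {..<n_sub D} = 0\<^sub>v m)
       (xO, xG)"

definition full_lspg_solution ::
  "dd_system \<Rightarrow> (nat \<Rightarrow> real mat) \<Rightarrow> nat \<Rightarrow> (nat \<Rightarrow> real mat) \<Rightarrow> (nat \<Rightarrow> nat) \<Rightarrow>
   (nat \<Rightarrow> real mat) \<Rightarrow> (nat \<Rightarrow> real mat) \<Rightarrow> (nat \<Rightarrow> real vec) \<Rightarrow> bool" where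
  "full_lspg_solution D B m A p PhiO PhiG x \<longleftrightarrow>
     is_arg_min
       (\<lambda>w. lspg_objective D B (\<lambda>i. PhiO i *\<^sub>v w i) (\<lambda>i. PhiG i *\<^sub>v w i))
       (\<lambda>w.
          (\<forall>i<n_sub D. w i \<in> carrier_vec (p i)) \<and>
          finsum_vec TYPE(real) m (\<lambda>i. A i *\<^sub>v (PhiG i *\<^sub>v w i)) {..<n_sub D} = 0\<^sub>v m)
       x"

fun global_lspg_solution ::
  "dd_system \<Rightarrow> (nat \<Rightarrow> real mat) \<Rightarrow> nat \<Rightarrow> (nat \<Rightarrow> real mat) \<Rightarrow> rom_bases \<Rightarrow> real vec \<Rightarrow> bool" where
  "global_lspg_solution D B m A (Interior_Boundary pO pG PhiO PhiG) xt \<longleftrightarrow>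
     xt \<in> carrier_vec (n_dof D) \<and>
     (\<exists>xO xG. ib_lspg_solution D B m A pO pG PhiO PhiG xO xG \<and>
        (\<forall>i<n_sub D. P_int D i *\<^sub>v xt = PhiO i *\<^sub>v xO i \<and> P_ifc D i *\<^sub>v xt = PhiG i *\<^sub>v xG i))"
| "global_lspg_solution D B m A (Full_Subdomain p Phi) xt \<longleftrightarrow>
     xt \<in> carrier_vec (n_dof D) \<and>
     (let PhiO = Phi_int D (Full_Subdomain p Phi); PhiG = Phi_ifc D (Full_Subdomain p Phi) in
      \<exists>xh. full_lspg_solution D B m A p PhiO PhiG xh \<and>
        (\<forall>i<n_sub D. P_int D i *\<^sub>v xt = PhiO i *\<^sub>v xh i \<and> P_ifc D i *\<^sub>v xt = PhiG i *\<^sub>v xh i))"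

definition Abar_mat :: "dd_system \<Rightarrow> nat \<Rightarrow> (nat \<Rightarrow> real mat) \<Rightarrow> rom_bases \<Rightarrow> real mat" where
  "Abar_mat D m Abar bs =
     mat_of_cols m (concat (map (\<lambda>i. cols (Abar i * Phi_ifc D bs i)) [0..<n_sub D]))"

definition null_basis_mat ::
  "dd_system \<Rightarrow> nat \<Rightarrow> (nat \<Rightarrow> real mat) \<Rightarrow> rom_bases \<Rightarrow> real mat \<Rightarrow> bool" where
  "null_basis_mat D m Abar bs N \<longleftrightarrow>
     (let q = \<Sum>i<n_sub D. p_ifc bs i; M = Abar_mat D m Abar bs in
      N \<in> carrier_mat q (q - vec_space.rank m M) \<and>
      distinct (cols N) \<and> kernel.basis q M (set (cols N)))"

definition row_block :: "(nat \<Rightarrow> nat) \<Rightarrow> real mat \<Rightarrow> nat \<Rightarrow> real mat" where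
  "row_block q N i = mat (q i) (dim_col N) (\<lambda>(a, b). N $$ ((\<Sum>k<i. q k) + a, b))"

text \<open>With \<open>null_basis_mat D m Abar bs N\<close>, the number \<open>dim_col N\<close> is the nullity of \<open>Abar_mat D m Abar bs\<close>.\<close>

fun trial_space :: "dd_system \<Rightarrow> rom_bases \<Rightarrow> real mat \<Rightarrow> real vec set" where
  "trial_space D (Interior_Boundary pO pG PhiO PhiG) N =
     {w \<in> carrier_vec (n_dof D).
        \<exists>wO wn. (\<forall>i<n_sub D. wO i \<in> carrier_vec (pO i)) \<and> wn \<in> carrier_vec (dim_col N) \<and>
          (\<forall>i<n_sub D. P_int D i *\<^sub>v w = PhiO i *\<^sub>v wO i \<and>
                       P_ifc D i *\<^sub>v w = PhiG i *\<^sub>v (row_block pG N i *\<^sub>v wn))}"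
| "trial_space D (Full_Subdomain p Phi) N =
     {w \<in> carrier_vec (n_dof D).
        \<exists>wn \<in> carrier_vec (dim_col N).
          \<forall>i<n_sub D.
            P_int D i *\<^sub>v w = Phi_int D (Full_Subdomain p Phi) i *\<^sub>v (row_block p N i *\<^sub>v wn) \<and>
            P_ifc D i *\<^sub>v w = Phi_ifc D (Full_Subdomain p Phi) i *\<^sub>v (row_block p N i *\<^sub>v wn)}"

end

theory Submission
  imports Defs
begin

text \<open>Write \<open>R w\<close> for the stack of the subdomain residuals at the global state \<open>w\<close>, \<open>BR w\<close> for the
  stack of their images under the \<open>B\<^sub>i\<close>, and \<open>S\<close> for the trial space. Three facts carry the proof.

  The first is that the constrained minimization over the coordinates of the subdomains is a minimization
  of \<open>\<bar>BR w\<bar>\<close> over \<open>S\<close>. Interface coordinates are feasible exactly if their concatenation lies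
  in the kernel of the constraint matrix, that is, if they are the row blocks of \<open>N u\<close> for some \<open>u\<close>
  (\<open>feasible_iff_null_basis_coords\<close>). Hence the global solution lies in \<open>S\<close>, and the coordinates of
  any \<open>w\<close> in \<open>S\<close> are a feasible competitor (\<open>global_lspg_solution_minimizes\<close>).

  The second is that all subdomain residuals vanish at the full-order solution \<open>x\<close>: the residual
  sampling matrices have orthonormal rows and are mutually orthogonal, so \<open>P\<^sub>i\<^sup>r\<close> recovers the \<open>i\<close>th residual
  from the assembled one (\<open>P_res_r_glob\<close>). Norms of residuals at \<open>w\<close> are therefore norms of
  differences to the residuals at \<open>x\<close>, which the assumptions compare
  with the distance of the states: for every \<open>w\<close> in \<open>S\<close>,
  \<open>P \<kappa>\<^sub>l \<bar>x - xt\<bar> \<le> P \<bar>R xt\<bar> \<le> \<bar>BR xt\<bar> \<le> \<bar>BR w\<bar> \<le> \<kappa>\<^sub>u \<bar>w - x\<bar>\<close>.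

  The third is that the minimum over \<open>S\<close> is attained. Since \<open>S\<close> is a linear subspace
  (\<open>linear_subspace_trial_space\<close>), the orthogonal projection of \<open>x\<close> is a nearest point
  (\<open>ex_nearest_point\<close>).\<close>

section \<open>Vectors divided into blocks\<close>

lemma block_index_less:
  fixes q :: "nat \<Rightarrow> nat"
  assumes "i < n" "b < q i"
  shows "(\<Sum>k<i. q k) + b < (\<Sum>k<n. q k)"
proof -
  have "(\<Sum>k<i. q k) + b < (\<Sum>k<Suc i. q k)"
    using assms by simp
  also have "\<dots> \<le> (\<Sum>k<n. q k)"
    using assms by (intro sum_mono2) auto
  finally show ?thesis .
qed

lemma sum_lessThan_add:
  fixes f :: "nat \<Rightarrow> 'a::comm_monoid_add"
  shows "(\<Sum>k<a + b. f k) = (\<Sum>k<a. f k) + (\<Sum>k<b. f (a + k))"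
  by (induction b) (auto simp: add.assoc)

lemma sum_over_blocks:
  fixes f :: "nat \<Rightarrow> 'a::comm_monoid_add" and q :: "nat \<Rightarrow> nat"
  shows "(\<Sum>k<(\<Sum>i<n. q i). f k) = (\<Sum>i<n. \<Sum>b<q i. f ((\<Sum>k<i. q k) + b))"
  by (induction n) (auto simp: sum_lessThan_add)

lemma length_concat_blocks: "length (concat (map f [0..<n])) = (\<Sum>k<n. length (f k))"
  by (induction n) auto

text \<open>Serves both for the columns of \<open>Abar_mat\<close>, a concatenation of the columns of its blocks, and for the
  vector with prescribed blocks.\<close>

lemma nth_concat_blocks:
  assumes "i < n" "b < length (f i)"
  shows "concat (map f [0..<n]) ! ((\<Sum>k<i. length (f k)) + b) = f i ! b"
  using assms(1)
proof (induction n)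
  case (Suc n)
  show ?case
  proof (cases "i < n")
    case True
    then show ?thesis
      using Suc.IH block_index_less[of i n b "\<lambda>k. length (f k)"] assms(2)
      by (simp add: nth_append length_concat_blocks)
  next
    case False
    then have "i = n" using Suc.prems by simp
    then show ?thesis by (simp add: nth_append length_concat_blocks)
  qed
qed simp

text \<open>The counterpart of \<open>row_block\<close> for vectors; the blocks are consecutive and have lengths \<open>q 0, q 1, ...\<close>\<close>

definition vec_block :: "(nat \<Rightarrow> nat) \<Rightarrow> 'a vec \<Rightarrow> nat \<Rightarrow> 'a vec" where
  "vec_block q z i = vec (q i) (\<lambda>b. z $ ((\<Sum>k<i. q k) + b))"

lemma vec_block_carrier [simp]: "vec_block q z i \<in> carrier_vec (q i)"
  by (simp add: vec_block_def)

lemma ex_vec_with_blocks: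
  assumes "\<And>i. i < n \<Longrightarrow> u i \<in> carrier_vec (q i)"
  obtains z where "z \<in> carrier_vec (\<Sum>i<n. q i)" "\<And>i. i < n \<Longrightarrow> vec_block q z i = u i"
proof
  let ?xs = "concat (map (\<lambda>i. list_of_vec (u i)) [0..<n])"
  have dim: "length (list_of_vec (u i)) = q i" if "i < n" for i
    using assms[OF that] by simp
  have off: "(\<Sum>k<i. length (list_of_vec (u k))) = (\<Sum>k<i. q k)" if "i \<le> n" for i
    using that dim by (intro sum.cong) auto
  show "vec_of_list ?xs \<in> carrier_vec (\<Sum>i<n. q i)"
    using off[of n] by (intro carrier_vecI) (simp add: length_concat_blocks)
  show "vec_block q (vec_of_list ?xs) i = u i" if i: "i < n" for i
  proof (rule eq_vecI)
    fix b assume "b < dim_vec (u i)"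
    then show "vec_block q (vec_of_list ?xs) i $ b = u i $ b"
      using nth_concat_blocks[OF i, of b "\<lambda>i. list_of_vec (u i)"] off[of i] dim[OF i] i
      by (simp add: vec_block_def vec_of_list_index list_of_vec_index)
  qed (use dim[OF i] in \<open>simp add: vec_block_def\<close>)
qed

lemma row_block_mult_vec:
  assumes "N \<in> carrier_mat (\<Sum>i<n. q i) c" "i < n"
  shows "row_block q N i *\<^sub>v u = vec_block q (N *\<^sub>v u) i"
proof (rule eq_vecI)
  fix b assume "b < dim_vec (vec_block q (N *\<^sub>v u) i)"
  then have b: "b < q i" by (simp add: vec_block_def)
  then have "row (row_block q N i) b = row N ((\<Sum>k<i. q k) + b)"
    using assms block_index_less[of i n b q] by (intro eq_vecI) (auto simp: row_block_def)
  then show "(row_block q N i *\<^sub>v u) $ b = vec_block q (N *\<^sub>v u) i $ b"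
    using b assms block_index_less[of i n b q] by (simp add: vec_block_def row_block_def)
qed (simp add: vec_block_def row_block_def)

section \<open>Sums and images of vectors\<close>

lemma finsum_vec_cong:
  fixes f g :: "'b \<Rightarrow> 'a::comm_monoid_add vec"
  assumes "\<And>i. i \<in> F \<Longrightarrow> g i \<in> carrier_vec n" "\<And>i. i \<in> F \<Longrightarrow> f i = g i"
  shows "finsum_vec TYPE('a) n f F = finsum_vec TYPE('a) n g F"
  using comm_monoid.finprod_cong'[OF comm_monoid_vec, of F F g n f] assms
  by (auto simp: finsum_vec_def monoid_vec_simps)

lemma mult_mat_zero_vec:
  "A \<in> carrier_mat m n \<Longrightarrow> A *\<^sub>v 0\<^sub>v n = 0\<^sub>v m"
  by (intro eq_vecI) (auto simp: scalar_prod_def)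

lemma mult_mat_finsum_vec:
  fixes A :: "'a::comm_semiring_1 mat"
  assumes A: "A \<in> carrier_mat m n" and "finite F" and "\<And>i. i \<in> F \<Longrightarrow> f i \<in> carrier_vec n"
  shows "A *\<^sub>v finsum_vec TYPE('a) n f F = finsum_vec TYPE('a) m (\<lambda>i. A *\<^sub>v f i) F"
  using assms(2,3)
proof (induction F rule: finite_induct)
  case empty
  show ?case using mult_mat_zero_vec[OF A] by (simp add: finsum_vec_empty)
next
  case (insert i F)
  then have f: "f \<in> F \<rightarrow> carrier_vec n" "f i \<in> carrier_vec n"
    and Af: "(\<lambda>i. A *\<^sub>v f i) \<in> F \<rightarrow> carrier_vec m" "A *\<^sub>v f i \<in> carrier_vec m"
    using A by auto
  show ?case
    unfolding finsum_vec_insert[OF insert.hyps f] finsum_vec_insert[OF insert.hyps Af]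
    using mult_add_distrib_mat_vec[OF A f(2) finsum_vec_closed[OF f(1)]] insert by simp
qed

lemma mult_mat_vec_linear_comb:
  fixes A :: "'a::field mat"
  assumes "A \<in> carrier_mat m n" "v \<in> carrier_vec n" "w \<in> carrier_vec n"
  shows "A *\<^sub>v (c \<cdot>\<^sub>v v + w) = c \<cdot>\<^sub>v (A *\<^sub>v v) + A *\<^sub>v w"
  using assms by (simp add: mult_add_distrib_mat_vec mult_mat_vec)

section \<open>The null space of the constraint matrix\<close>

lemma Abar_mat_carrier:
  assumes "\<And>i. i < n_sub D \<Longrightarrow> Phi_ifc D bs i \<in> carrier_mat (n_ifc D i) (p_ifc bs i)"
  shows "Abar_mat D m Abar bs \<in> carrier_mat m (\<Sum>i<n_sub D. p_ifc bs i)"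
proof -
  have "(\<Sum>i<n_sub D. dim_col (Abar i * Phi_ifc D bs i)) = (\<Sum>i<n_sub D. p_ifc bs i)"
    using assms by (intro sum.cong) auto
  then show ?thesis
    unfolding Abar_mat_def by (intro carrier_matI) (simp_all add: length_concat_blocks)
qed

text \<open>Block multiplication, entry by entry: the column index of \<open>Abar_mat\<close> runs through the blocks, and each
  block contributes one summand of the constraint.\<close>

lemma Abar_mat_mult_vec:
  assumes Phi: "\<And>i. i < n_sub D \<Longrightarrow> Phi_ifc D bs i \<in> carrier_mat (n_ifc D i) (p_ifc bs i)"
    and Abar: "\<And>i. i < n_sub D \<Longrightarrow> Abar i \<in> carrier_mat m (n_ifc D i)"
    and z: "z \<in> carrier_vec (\<Sum>i<n_sub D. p_ifc bs i)"
  shows "Abar_mat D m Abar bs *\<^sub>v z =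
    finsum_vec TYPE(real) m
      (\<lambda>i. Abar i *\<^sub>v (Phi_ifc D bs i *\<^sub>v vec_block (p_ifc bs) z i)) {..<n_sub D}"
    (is "?M *\<^sub>v z = finsum_vec _ m ?g _")
proof -
  let ?q = "p_ifc bs"
  let ?C = "\<lambda>i. Abar i * Phi_ifc D bs i"
  have C: "?C i \<in> carrier_mat m (?q i)" if "i < n_sub D" for i
    using Phi[OF that] Abar[OF that] by auto
  have M: "?M \<in> carrier_mat m (\<Sum>i<n_sub D. ?q i)"
    using Phi by (rule Abar_mat_carrier)
  have g: "?g \<in> {..<n_sub D} \<rightarrow> carrier_vec m"
    using Abar by (auto intro!: mult_mat_vec_carrier Phi)
  have dim: "length (cols (?C i)) = ?q i" if "i < n_sub D" for i
    using carrier_matD(2)[OF C[OF that]] by (simp del: index_mult_mat)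
  have off: "(\<Sum>k<i. length (cols (?C k))) = (\<Sum>k<i. ?q k)" if "i \<le> n_sub D" for i
    using that dim by (intro sum.cong) auto
  have entry: "?M $$ (a, (\<Sum>k<i. ?q k) + b) = ?C i $$ (a, b)"
    if "a < m" "i < n_sub D" "b < ?q i" for a i b
  proof -
    have "?M $$ (a, (\<Sum>k<i. ?q k) + b) =
        concat (map (\<lambda>i. cols (?C i)) [0..<n_sub D]) ! ((\<Sum>k<i. ?q k) + b) $ a"
      unfolding Abar_mat_def
      by (intro mat_of_cols_index)
        (use that off[of "n_sub D"] block_index_less[of i _ b ?q] in \<open>simp_all add: length_concat_blocks\<close>)
    also have "\<dots> = cols (?C i) ! b $ a"
      using nth_concat_blocks[of i _ b "\<lambda>i. cols (?C i)"] that off[of i] dim[of i] by simp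
    also have "\<dots> = ?C i $$ (a, b)"
      using carrier_matD[OF C[OF that(2)]] that by (simp add: cols_nth del: index_mult_mat)
    finally show ?thesis .
  qed
  show ?thesis
  proof (rule eq_vecI)
    have fs: "finsum_vec TYPE(real) m ?g {..<n_sub D} \<in> carrier_vec m"
      using g by (intro finsum_vec_closed)
    then show "dim_vec (?M *\<^sub>v z) = dim_vec (finsum_vec TYPE(real) m ?g {..<n_sub D})"
      using M by simp
    fix a assume "a < dim_vec (finsum_vec TYPE(real) m ?g {..<n_sub D})"
    then have a: "a < m" using fs by simp
    have "(?M *\<^sub>v z) $ a = (\<Sum>k<(\<Sum>i<n_sub D. ?q i). ?M $$ (a, k) * z $ k)"
      using M a z by (simp add: scalar_prod_def atLeast0LessThan)
    also have "\<dots> = (\<Sum>i<n_sub D. \<Sum>b<?q i.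
        ?M $$ (a, (\<Sum>k<i. ?q k) + b) * z $ ((\<Sum>k<i. ?q k) + b))"
      by (rule sum_over_blocks)
    also have "\<dots> = (\<Sum>i<n_sub D. ?g i $ a)"
    proof (rule sum.cong)
      fix i assume "i \<in> {..<n_sub D}"
      then have i: "i < n_sub D" by simp
      have "?g i = ?C i *\<^sub>v vec_block ?q z i"
        using Abar[OF i] Phi[OF i] by (simp add: assoc_mult_mat_vec)
      also have "\<dots> $ a = (\<Sum>b<?q i. ?C i $$ (a, b) * z $ ((\<Sum>k<i. ?q k) + b))"
        using C[OF i] a by (simp add: scalar_prod_def atLeast0LessThan vec_block_def del: index_mult_mat)
      finally show "(\<Sum>b<?q i. ?M $$ (a, (\<Sum>k<i. ?q k) + b) * z $ ((\<Sum>k<i. ?q k) + b)) = ?g i $ a"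
        using entry[OF a i] by simp
    qed simp
    also have "\<dots> = finsum_vec TYPE(real) m ?g {..<n_sub D} $ a"
      using g a by (intro index_finsum_vec[symmetric]) auto
    finally show "(?M *\<^sub>v z) $ a = finsum_vec TYPE(real) m ?g {..<n_sub D} $ a" .
  qed
qed

text \<open>The basis property is about linear combinations of the set of columns; since the columns are distinct,
  these are the products of the matrix with coefficient vectors.\<close>

lemma kernel_eq_range_basis:
  fixes M :: "real mat"
  assumes M: "M \<in> carrier_mat m q" and N: "N \<in> carrier_mat q c"
    and dist: "distinct (cols N)" and basis: "kernel.basis q M (set (cols N))"
  shows "mat_kernel M = {N *\<^sub>v u | u. u \<in> carrier_vec c}"
proof -
  interpret kernel m q M by unfold_locales (rule M)
  have sub: "set (cols N) \<subseteq> mat_kernel M" and gen: "span (set (cols N)) = mat_kernel M"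
    using basis unfolding Ker.basis_def by auto
  have carr: "set (cols N) \<subseteq> carrier_vec q"
    using cols_dim[of N] N by auto
  have "mat_kernel M = NC.span (set (cols N))"
    using gen span_same[OF sub] by simp
  also have "\<dots> = {NC.lincomb a (set (cols N)) | a. a \<in> set (cols N) \<rightarrow> UNIV}"
    using NC.finite_span[of "set (cols N)"] carr by simp
  also have "\<dots> = {N *\<^sub>v u | u. u \<in> carrier_vec c}"
  proof (intro equalityI subsetI)
    fix v assume "v \<in> {NC.lincomb a (set (cols N)) | a. a \<in> set (cols N) \<rightarrow> UNIV}"
    then obtain a where "v = NC.lincomb a (set (cols N))" by auto
    then have "v = N *\<^sub>v vec c (\<lambda>i. a (col N i))"
      using NC.mat_mult_eq_lincomb[OF N dist] by simp
    then show "v \<in> {N *\<^sub>v u | u. u \<in> carrier_vec c}" by auto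
  next
    fix v assume "v \<in> {N *\<^sub>v u | u. u \<in> carrier_vec c}"
    then obtain u where "u \<in> carrier_vec c" "v = N *\<^sub>v u" by auto
    then have "v = NC.lincomb (\<lambda>a. u $ find_first a (cols N)) (set (cols N))"
      using NC.lincomb_eq_mat_mult[OF N _ dist] by simp
    then show "v \<in> {NC.lincomb a (set (cols N)) | a. a \<in> set (cols N) \<rightarrow> UNIV}"
      by blast
  qed
  finally show ?thesis .
qed

text \<open>Concatenating the coordinates turns the constraint into membership in the kernel of the constraint matrix,
  and this kernel is the range of \<open>N\<close>. So the coefficients \<open>u\<close> parametrize the feasible coordinates,
  which removes the constraint.\<close>

lemma feasible_iff_null_basis_coords:
  assumes Phi: "\<And>i. i < n_sub D \<Longrightarrow> Phi_ifc D bs i \<in> carrier_mat (n_ifc D i) (p_ifc bs i)"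
    and Abar: "\<And>i. i < n_sub D \<Longrightarrow> Abar i \<in> carrier_mat m (n_ifc D i)"
    and N: "null_basis_mat D m Abar bs N"
  shows "(\<forall>i<n_sub D. w i \<in> carrier_vec (p_ifc bs i)) \<and>
      finsum_vec TYPE(real) m (\<lambda>i. Abar i *\<^sub>v (Phi_ifc D bs i *\<^sub>v w i)) {..<n_sub D} = 0\<^sub>v m \<longleftrightarrow>
    (\<exists>u\<in>carrier_vec (dim_col N). \<forall>i<n_sub D. w i = row_block (p_ifc bs) N i *\<^sub>v u)"
    (is "?feasible \<longleftrightarrow> ?coords")
proof -
  let ?q = "p_ifc bs" and ?M = "Abar_mat D m Abar bs"
  have M: "?M \<in> carrier_mat m (\<Sum>i<n_sub D. ?q i)"
    using Phi by (rule Abar_mat_carrier)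
  have Nc: "N \<in> carrier_mat (\<Sum>i<n_sub D. ?q i) (dim_col N)"
    and "distinct (cols N)" "kernel.basis (\<Sum>i<n_sub D. ?q i) ?M (set (cols N))"
    using N by (auto simp: null_basis_mat_def Let_def)
  then have ker: "mat_kernel ?M = {N *\<^sub>v u | u. u \<in> carrier_vec (dim_col N)}"
    using M by (intro kernel_eq_range_basis)
  have constraint: "finsum_vec TYPE(real) m (\<lambda>i. Abar i *\<^sub>v (Phi_ifc D bs i *\<^sub>v w i)) {..<n_sub D}
      = ?M *\<^sub>v z"
    if "z \<in> carrier_vec (\<Sum>i<n_sub D. ?q i)" "\<And>i. i < n_sub D \<Longrightarrow> vec_block ?q z i = w i" for z
  proof -
    have "finsum_vec TYPE(real) m (\<lambda>i. Abar i *\<^sub>v (Phi_ifc D bs i *\<^sub>v w i)) {..<n_sub D} =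
        finsum_vec TYPE(real) m
          (\<lambda>i. Abar i *\<^sub>v (Phi_ifc D bs i *\<^sub>v vec_block ?q z i)) {..<n_sub D}"
      using that(2) by (intro finsum_vec_cong)
        (auto intro!: mult_mat_vec_carrier[OF Abar] mult_mat_vec_carrier[OF Phi] simp flip: that(2))
    also have "\<dots> = ?M *\<^sub>v z"
      using Abar_mat_mult_vec[of D bs Abar m z] Phi Abar that(1) by simp
    finally show ?thesis .
  qed
  show ?thesis
  proof
    assume feas: ?feasible
    then obtain z where z: "z \<in> carrier_vec (\<Sum>i<n_sub D. ?q i)"
      "\<And>i. i < n_sub D \<Longrightarrow> vec_block ?q z i = w i"
      using ex_vec_with_blocks[of "n_sub D" w ?q] by blast
    have "z \<in> mat_kernel ?M"
      using feas constraint[OF z] by (intro mat_kernelI[OF M z(1)]) simp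
    then obtain u where u: "u \<in> carrier_vec (dim_col N)" "z = N *\<^sub>v u"
      using ker by auto
    then have "\<forall>i<n_sub D. w i = row_block ?q N i *\<^sub>v u"
      using z(2) row_block_mult_vec[OF Nc] by auto
    with u(1) show ?coords by auto
  next
    assume ?coords
    then obtain u where u: "u \<in> carrier_vec (dim_col N)"
      and w: "\<And>i. i < n_sub D \<Longrightarrow> w i = vec_block ?q (N *\<^sub>v u) i"
      using row_block_mult_vec[OF Nc] by auto
    have "N *\<^sub>v u \<in> mat_kernel ?M"
      using ker u by auto
    then have z: "N *\<^sub>v u \<in> carrier_vec (\<Sum>i<n_sub D. ?q i)" "?M *\<^sub>v (N *\<^sub>v u) = 0\<^sub>v m"
      using mat_kernelD[OF M] by auto
    show ?feasible
      using constraint[OF z(1)] w z(2) by simp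
  qed
qed


section \<open>Residuals at the full-order solution\<close>

lemma sampling_mat_carrier: "sampling_mat m n P \<Longrightarrow> P \<in> carrier_mat m n"
  by (simp add: sampling_mat_def)

lemma sampling_mat_orthonormal_rows:
  assumes "sampling_mat m n P"
  shows "P * transpose_mat P = 1\<^sub>m m"
proof -
  obtain f where P: "P \<in> carrier_mat m n" and f: "inj_on f {..<m}" "f ` {..<m} \<subseteq> {..<n}"
    and row: "\<And>k. k < m \<Longrightarrow> row P k = row (1\<^sub>m n) (f k)"
    using assms by (auto simp: sampling_mat_def)
  have f_less: "f k < n" if "k < m" for k
    using f(2) that by auto
  show ?thesis
  proof (rule eq_matI)
    fix k l assume "k < dim_row (1\<^sub>m m)" "l < dim_col (1\<^sub>m m)"
    then have kl: "k < m" "l < m" by auto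
    then show "(P * transpose_mat P) $$ (k, l) = 1\<^sub>m m $$ (k, l)"
      using P row f_less f(1) by (auto simp: inj_on_eq_iff)
  qed (use P in auto)
qed

context decomposed_system
begin

lemma sub_res_carrier:
  assumes "i < n_sub D" "w \<in> carrier_vec (n_dof D)"
  shows "sub_res D i w \<in> carrier_vec (n_res D i)"
  unfolding sub_res_def
  by (intro r_loc mult_mat_vec_carrier[where n = "n_dof D"] sampling_mat_carrier P_int P_ifc assms)

text \<open>In \<open>P\<^sub>i \<Sum>\<^sub>j P\<^sub>j\<^sup>T s\<^sub>j\<close> the mutual orthogonality removes the terms with \<open>j \<noteq> i\<close>, and the orthonormal rows of
  \<open>P\<^sub>i\<close> leave \<open>s\<^sub>i\<close>.\<close>

lemma P_res_r_glob:
  assumes i: "i < n_sub D" and w: "w \<in> carrier_vec (n_dof D)"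
  shows "P_res D i *\<^sub>v r_glob D w = sub_res D i w"
proof -
  let ?P = "P_res D" and ?s = "\<lambda>j. sub_res D j w"
  have P: "?P j \<in> carrier_mat (n_res D j) (n_dof D)" if "j < n_sub D" for j
    using sampling_mat_carrier[OF P_res[OF that]] .
  have s: "?s j \<in> carrier_vec (n_res D j)" if "j < n_sub D" for j
    using sub_res_carrier[OF that w] .
  have pick: "?P i *\<^sub>v (transpose_mat (?P j) *\<^sub>v ?s j) = (if j = i then ?s i else 0\<^sub>v (n_res D i))"
    if j: "j < n_sub D" for j
  proof -
    have "?P i *\<^sub>v (transpose_mat (?P j) *\<^sub>v ?s j) = (?P i * transpose_mat (?P j)) *\<^sub>v ?s j"
      using P[OF i] P[OF j] s[OF j] by (intro assoc_mult_mat_vec[symmetric]) auto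
    then show ?thesis
      using P_res_orth[OF i j] sampling_mat_orthonormal_rows[OF P_res[OF i]] s[OF i] s[OF j] by auto
  qed
  have "?P i *\<^sub>v r_glob D w =
      finsum_vec TYPE(real) (n_res D i) (\<lambda>j. ?P i *\<^sub>v (transpose_mat (?P j) *\<^sub>v ?s j)) {..<n_sub D}"
    unfolding r_glob[OF w]
    using P s by (intro mult_mat_finsum_vec[OF P[OF i]]) (auto intro!: mult_mat_vec_carrier)
  also have "\<dots> = finsum_vec TYPE(real) (n_res D i)
      (\<lambda>j. if j = i then ?s i else 0\<^sub>v (n_res D i)) {..<n_sub D}"
    using pick s[OF i] by (intro finsum_vec_cong) auto
  also have "\<dots> = ?s i"
  proof (rule eq_vecI)
    have carr: "(\<lambda>j. if j = i then ?s i else 0\<^sub>v (n_res D i)) \<in> {..<n_sub D} \<rightarrow> carrier_vec (n_res D i)"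
      using s[OF i] by auto
    show "dim_vec (finsum_vec TYPE(real) (n_res D i)
        (\<lambda>j. if j = i then ?s i else 0\<^sub>v (n_res D i)) {..<n_sub D}) = dim_vec (?s i)"
      using finsum_vec_closed[OF carr] s[OF i] by simp
    fix k assume "k < dim_vec (?s i)"
    then have k: "k < n_res D i" using s[OF i] by simp
    have "finsum_vec TYPE(real) (n_res D i)
        (\<lambda>j. if j = i then ?s i else 0\<^sub>v (n_res D i)) {..<n_sub D} $ k
        = (\<Sum>j<n_sub D. if j = i then ?s i $ k else 0)"
      unfolding index_finsum_vec[OF finite_lessThan k carr] using k by (intro sum.cong) auto
    then show "finsum_vec TYPE(real) (n_res D i)
        (\<lambda>j. if j = i then ?s i else 0\<^sub>v (n_res D i)) {..<n_sub D} $ k = ?s i $ k"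
      using i by simp
  qed
  finally show ?thesis .
qed

lemma sub_res_eq_zero:
  assumes "i < n_sub D" "x \<in> carrier_vec (n_dof D)" "r_glob D x = 0\<^sub>v (n_dof D)"
  shows "sub_res D i x = 0\<^sub>v (n_res D i)"
  using P_res_r_glob[OF assms(1,2)] mult_mat_zero_vec[OF sampling_mat_carrier[OF P_res[OF assms(1)]]]
    assms(3) by simp

end

section \<open>Nearest points in linear subspaces\<close>

lemma norm2_sq: "(norm2 v)\<^sup>2 = v \<bullet> v"
  by (simp add: norm2_def L2_set_def scalar_prod_def sum_nonneg power2_eq_square atLeast0LessThan)

lemma norm2_nonneg: "0 \<le> norm2 v"
  by (simp add: norm2_def)

lemma norm2_minus_commute:
  assumes "v \<in> carrier_vec n" "w \<in> carrier_vec n"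
  shows "norm2 (v - w) = norm2 (w - v)"
proof -
  have "(norm2 (v - w))\<^sup>2 = (norm2 (w - v))\<^sup>2"
    unfolding norm2_sq using assms
    by (auto simp: scalar_prod_def algebra_simps intro!: sum.cong)
  then show ?thesis
    using norm2_nonneg by (metis power2_eq_imp_eq)
qed

definition linear_subspace :: "nat \<Rightarrow> real vec set \<Rightarrow> bool" where
  "linear_subspace n S \<longleftrightarrow> S \<subseteq> carrier_vec n \<and> 0\<^sub>v n \<in> S \<and>
     (\<forall>v\<in>S. \<forall>w\<in>S. \<forall>c. c \<cdot>\<^sub>v v + w \<in> S)"

text \<open>A Gram-Schmidt step for each coordinate: induction on a bound \<open>k\<close> such that all vectors of the subspace
  vanish from coordinate \<open>k\<close> on. If some \<open>v\<close> in the subspace has a nonzero entry at the last admitted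
  coordinate, the vectors with entry zero there form a smaller subspace \<open>T\<close>. The part \<open>e\<close> of \<open>v\<close>
  orthogonal to \<open>T\<close> spans the subspace together with \<open>T\<close>, so the projection onto the subspace is the
  projection onto \<open>T\<close> plus the one onto \<open>e\<close>.\<close>

lemma ex_orthogonal_projection:
  assumes "linear_subspace n S" "x \<in> carrier_vec n"
  shows "\<exists>w\<in>S. \<forall>s\<in>S. (x - w) \<bullet> s = 0"
proof -
  have "\<exists>w\<in>S. \<forall>s\<in>S. (x - w) \<bullet> s = 0"
    if "linear_subspace n S" "x \<in> carrier_vec n" "k \<le> n" "\<And>s j. s \<in> S \<Longrightarrow> k \<le> j \<Longrightarrow> j < n \<Longrightarrow> s $ j = 0"
    for k S x
    using that
  proof (induction k arbitrary: S x)
    case 0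
    then have "0\<^sub>v n \<in> S" and carr: "S \<subseteq> carrier_vec n"
      by (auto simp: linear_subspace_def)
    moreover have "s = 0\<^sub>v n" if "s \<in> S" for s
      using 0(4)[OF that] carr that by (intro eq_vecI) auto
    ultimately have "S = {0\<^sub>v n}" by blast
    then show ?case
      using 0(2) by simp
  next
    case (Suc k)
    have carr: "\<And>s. s \<in> S \<Longrightarrow> s \<in> carrier_vec n"
      and comb: "\<And>v w c. v \<in> S \<Longrightarrow> w \<in> S \<Longrightarrow> c \<cdot>\<^sub>v v + w \<in> S"
      using Suc.prems(1) by (auto simp: linear_subspace_def)
    have k: "k < n" using Suc.prems(3) by simp
    let ?T = "{s \<in> S. s $ k = 0}"
    have "(c \<cdot>\<^sub>v v + w) $ k = 0" if "v \<in> ?T" "w \<in> ?T" for c v w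
      using that k carr[of v] carr[of w] by auto
    then have T: "linear_subspace n ?T"
      using Suc.prems(1) k by (auto simp: linear_subspace_def)
    have T0: "s $ j = 0" if "s \<in> ?T" "k \<le> j" "j < n" for s j
      using that Suc.prems(4)[of s j] by (cases "j = k") auto
    have proj: "\<exists>w\<in>?T. \<forall>s\<in>?T. (y - w) \<bullet> s = 0" if "y \<in> carrier_vec n" for y
      using T0 k by (intro Suc.IH[OF T that]) auto
    show ?case
    proof (cases "\<exists>v\<in>S. v $ k \<noteq> 0")
      case False
      then have "?T = S" by auto
      then show ?thesis using proj[OF Suc.prems(2)] by simp
    next
      case True
      then obtain v where v: "v \<in> S" "v $ k \<noteq> 0" by auto
      obtain u where u: "u \<in> ?T" "\<And>s. s \<in> ?T \<Longrightarrow> (v - u) \<bullet> s = 0"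
        using proj[OF carr[OF v(1)]] by auto
      obtain w where w: "w \<in> ?T" "\<And>s. s \<in> ?T \<Longrightarrow> (x - w) \<bullet> s = 0"
        using proj[OF Suc.prems(2)] by auto
      have cs: "v \<in> carrier_vec n" "u \<in> carrier_vec n" "w \<in> carrier_vec n" "x \<in> carrier_vec n"
        using v u w carr Suc.prems(2) by auto
      define e where "e = v - u"
      have e: "e \<in> carrier_vec n" "e $ k = v $ k"
        using cs k u by (auto simp: e_def)
      have "(-1) \<cdot>\<^sub>v u + v = e"
        using cs by (intro eq_vecI) (auto simp: e_def)
      then have eS: "e \<in> S" using comb[of u v "-1"] u v by simp
      have eT: "e \<bullet> s = 0" if "s \<in> ?T" for s
        using u(2)[OF that] by (simp add: e_def)
      \<comment> \<open>The entry of \<open>e\<close> at \<open>k\<close> is that of \<open>v\<close>, so \<open>e\<close> is nonzero.\<close>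
      have ee: "e \<bullet> e \<noteq> 0"
      proof
        assume "e \<bullet> e = 0"
        then have "(\<Sum>j<n. e $ j * e $ j) = 0"
          using e(1) by (simp add: scalar_prod_def atLeast0LessThan)
        then have "e $ k * e $ k = 0"
          using k by (subst (asm) sum_nonneg_eq_0_iff) auto
        then show False using e(2) v(2) by simp
      qed
      define c where "c = ((x - w) \<bullet> e) / (e \<bullet> e)"
      have split: "(x - (c \<cdot>\<^sub>v e + w)) \<bullet> s = (x - w) \<bullet> s - c * (e \<bullet> s)" if "s \<in> carrier_vec n" for s
      proof -
        have "x - (c \<cdot>\<^sub>v e + w) = (x - w) - c \<cdot>\<^sub>v e"
          using cs e by (intro eq_vecI) auto
        then show ?thesis
          using that cs e by (simp add: minus_scalar_prod_distrib[of _ n])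
      qed
      have "(x - (c \<cdot>\<^sub>v e + w)) \<bullet> s = 0" if s: "s \<in> S" for s
      proof -
        \<comment> \<open>The multiple of \<open>e\<close> that cancels the entry of \<open>s\<close> at \<open>k\<close>, so that the rest lies in \<open>T\<close>.\<close>
        define d where "d = s $ k / v $ k"
        define t where "t = (- d) \<cdot>\<^sub>v e + s"
        have t: "t \<in> ?T"
          using comb[OF eS s, of "- d"] carr[OF s] e v(2) k by (auto simp: t_def d_def)
        have "s = d \<cdot>\<^sub>v e + t"
          using carr[OF s] e by (intro eq_vecI) (auto simp: t_def)
        moreover have "t \<in> carrier_vec n" using t carr by auto
        ultimately have dot: "y \<bullet> s = d * (y \<bullet> e) + y \<bullet> t" if "y \<in> carrier_vec n" for y
          using that e by (simp add: scalar_prod_add_distrib[of _ n])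
        show ?thesis
          using split[OF carr[OF s]] dot[of "x - w"] dot[OF e(1)] w(2)[OF t] eT[OF t] cs ee
          by (simp add: c_def)
      qed
      moreover have "c \<cdot>\<^sub>v e + w \<in> S"
        using comb eS w(1) by auto
      ultimately show ?thesis by blast
    qed
  qed
  from this[of S x n] show ?thesis using assms by auto
qed

text \<open>Pythagoras: the error of the orthogonal projection is orthogonal to the difference of two points of the
  subspace.\<close>

lemma ex_nearest_point:
  assumes S: "linear_subspace n S" and x: "x \<in> carrier_vec n"
  obtains ws where "is_arg_min (\<lambda>w. norm2 (x - w)) (\<lambda>w. w \<in> S) ws"
proof -
  have carr: "\<And>s. s \<in> S \<Longrightarrow> s \<in> carrier_vec n"
    and comb: "\<And>v w c. v \<in> S \<Longrightarrow> w \<in> S \<Longrightarrow> c \<cdot>\<^sub>v v + w \<in> S"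
    using S by (auto simp: linear_subspace_def)
  obtain ws where ws: "ws \<in> S" and orth: "\<And>s. s \<in> S \<Longrightarrow> (x - ws) \<bullet> s = 0"
    using ex_orthogonal_projection[OF S x] by auto
  have "norm2 (x - ws) \<le> norm2 (x - w)" if w: "w \<in> S" for w
  proof -
    define a where "a = x - ws"
    define d where "d = (-1) \<cdot>\<^sub>v w + ws"
    have d: "d \<in> S" using comb w ws by (simp add: d_def)
    have ad: "a \<in> carrier_vec n" "d \<in> carrier_vec n"
      using x carr[OF ws] carr[OF d] by (auto simp: a_def)
    have "x - w = a + d"
      using x carr[OF ws] carr[OF w] by (intro eq_vecI) (auto simp: a_def d_def)
    then have "(norm2 (x - w))\<^sup>2 = a \<bullet> a + 2 * (a \<bullet> d) + d \<bullet> d"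
      using ad comm_scalar_prod[OF ad(2,1)]
      by (simp add: norm2_sq scalar_prod_add_distrib[of _ n] add_scalar_prod_distrib[of _ n])
    also have "\<dots> \<ge> (norm2 a)\<^sup>2"
      using orth[OF d] by (simp add: a_def flip: norm2_sq)
    finally show ?thesis
      using norm2_nonneg by (auto simp: a_def intro: power2_le_imp_le)
  qed
  then have "is_arg_min (\<lambda>w. norm2 (x - w)) (\<lambda>w. w \<in> S) ws"
    using ws by (auto simp: is_arg_min_def not_less)
  then show ?thesis by (rule that)
qed

section \<open>The trial space and the global solution\<close>

lemma Phi_ifc_carrier:
  assumes "valid_bases D bs" "i < n_sub D"
  shows "Phi_ifc D bs i \<in> carrier_mat (n_ifc D i) (p_ifc bs i)"
  using assms by (cases bs) (auto simp: full_column_rank_def)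

lemma row_block_carrier: "row_block q N i \<in> carrier_mat (q i) (dim_col N)"
  by (simp add: row_block_def)

context decomposed_system
begin

lemmas P_int_carrier = sampling_mat_carrier[OF P_int]
  and P_ifc_carrier = sampling_mat_carrier[OF P_ifc]

text \<open>Membership is the existence of coordinates that satisfy homogeneous linear equations together with the
  state; linear combinations of states are witnessed by the same combinations of their coordinates.\<close>

lemma linear_subspace_trial_space:
  assumes "valid_bases D bs"
  shows "linear_subspace (n_dof D) (trial_space D bs N)"
proof (cases bs)
  case [simp]: (Interior_Boundary pO pG PhiO PhiG)
  have PhiO: "PhiO i \<in> carrier_mat (n_int D i) (pO i)"
    and PhiG: "PhiG i \<in> carrier_mat (n_ifc D i) (pG i)" if "i < n_sub D" for i
    using assms that by (auto simp: full_column_rank_def)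
  note R = row_block_carrier[of pG N]
  have "0\<^sub>v (n_dof D) \<in> trial_space D bs N"
    using mult_mat_zero_vec[OF P_int_carrier] mult_mat_zero_vec[OF P_ifc_carrier]
      mult_mat_zero_vec[OF PhiO] mult_mat_zero_vec[OF PhiG] mult_mat_zero_vec[OF R]
    by (auto intro!: exI[of _ "\<lambda>i. 0\<^sub>v (pO i)"] exI[of _ "0\<^sub>v (dim_col N)"])
  moreover have "c \<cdot>\<^sub>v v + w \<in> trial_space D bs N"
    if v: "v \<in> trial_space D bs N" and w: "w \<in> trial_space D bs N" for c v w
  proof -
    obtain vO vn where v': "v \<in> carrier_vec (n_dof D)" "vn \<in> carrier_vec (dim_col N)"
      "\<And>i. i < n_sub D \<Longrightarrow> vO i \<in> carrier_vec (pO i)"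
      "\<And>i. i < n_sub D \<Longrightarrow> P_int D i *\<^sub>v v = PhiO i *\<^sub>v vO i"
      "\<And>i. i < n_sub D \<Longrightarrow> P_ifc D i *\<^sub>v v = PhiG i *\<^sub>v (row_block pG N i *\<^sub>v vn)"
      using v by auto
    obtain wO wn where w': "w \<in> carrier_vec (n_dof D)" "wn \<in> carrier_vec (dim_col N)"
      "\<And>i. i < n_sub D \<Longrightarrow> wO i \<in> carrier_vec (pO i)"
      "\<And>i. i < n_sub D \<Longrightarrow> P_int D i *\<^sub>v w = PhiO i *\<^sub>v wO i"
      "\<And>i. i < n_sub D \<Longrightarrow> P_ifc D i *\<^sub>v w = PhiG i *\<^sub>v (row_block pG N i *\<^sub>v wn)"
      using w by auto
    have "P_int D i *\<^sub>v (c \<cdot>\<^sub>v v + w) = PhiO i *\<^sub>v (c \<cdot>\<^sub>v vO i + wO i)"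
      "P_ifc D i *\<^sub>v (c \<cdot>\<^sub>v v + w) = PhiG i *\<^sub>v (row_block pG N i *\<^sub>v (c \<cdot>\<^sub>v vn + wn))"
      if i: "i < n_sub D" for i
      using mult_mat_vec_linear_comb[OF P_int_carrier[OF i] v'(1) w'(1)]
        mult_mat_vec_linear_comb[OF P_ifc_carrier[OF i] v'(1) w'(1)]
        mult_mat_vec_linear_comb[OF PhiO[OF i] v'(3)[OF i] w'(3)[OF i]]
        mult_mat_vec_linear_comb[OF PhiG[OF i] mult_mat_vec_carrier[OF R v'(2)]
          mult_mat_vec_carrier[OF R w'(2)]]
        mult_mat_vec_linear_comb[OF R v'(2) w'(2)] v'(4,5)[OF i] w'(4,5)[OF i]
      by simp_all
    then show ?thesis
      using v'(1-3) w'(1-3)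
      by (auto intro!: exI[of _ "\<lambda>i. c \<cdot>\<^sub>v vO i + wO i"] exI[of _ "c \<cdot>\<^sub>v vn + wn"])
  qed
  ultimately show ?thesis
    unfolding linear_subspace_def by auto
next
  case [simp]: (Full_Subdomain p Phi)
  let ?PhiO = "Phi_int D (Full_Subdomain p Phi)" and ?PhiG = "Phi_ifc D (Full_Subdomain p Phi)"
  have PhiO: "?PhiO i \<in> carrier_mat (n_int D i) (p i)"
    and PhiG: "?PhiG i \<in> carrier_mat (n_ifc D i) (p i)" for i
    by auto
  note R = row_block_carrier[of p N]
  have "0\<^sub>v (n_dof D) \<in> trial_space D bs N"
    using mult_mat_zero_vec[OF P_int_carrier] mult_mat_zero_vec[OF P_ifc_carrier]
      mult_mat_zero_vec[OF PhiO] mult_mat_zero_vec[OF PhiG] mult_mat_zero_vec[OF R]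
    by (auto intro!: bexI[of _ "0\<^sub>v (dim_col N)"] simp del: Phi_int.simps Phi_ifc.simps)
  moreover have "c \<cdot>\<^sub>v v + w \<in> trial_space D bs N"
    if v: "v \<in> trial_space D bs N" and w: "w \<in> trial_space D bs N" for c v w
  proof -
    obtain vn where v': "v \<in> carrier_vec (n_dof D)" "vn \<in> carrier_vec (dim_col N)"
      "\<And>i. i < n_sub D \<Longrightarrow> P_int D i *\<^sub>v v = ?PhiO i *\<^sub>v (row_block p N i *\<^sub>v vn)"
      "\<And>i. i < n_sub D \<Longrightarrow> P_ifc D i *\<^sub>v v = ?PhiG i *\<^sub>v (row_block p N i *\<^sub>v vn)"
      using v by auto
    obtain wn where w': "w \<in> carrier_vec (n_dof D)" "wn \<in> carrier_vec (dim_col N)"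
      "\<And>i. i < n_sub D \<Longrightarrow> P_int D i *\<^sub>v w = ?PhiO i *\<^sub>v (row_block p N i *\<^sub>v wn)"
      "\<And>i. i < n_sub D \<Longrightarrow> P_ifc D i *\<^sub>v w = ?PhiG i *\<^sub>v (row_block p N i *\<^sub>v wn)"
      using w by auto
    have "P_int D i *\<^sub>v (c \<cdot>\<^sub>v v + w) = ?PhiO i *\<^sub>v (row_block p N i *\<^sub>v (c \<cdot>\<^sub>v vn + wn))"
      "P_ifc D i *\<^sub>v (c \<cdot>\<^sub>v v + w) = ?PhiG i *\<^sub>v (row_block p N i *\<^sub>v (c \<cdot>\<^sub>v vn + wn))"
      if i: "i < n_sub D" for i
      using mult_mat_vec_linear_comb[OF P_int_carrier[OF i] v'(1) w'(1)]
        mult_mat_vec_linear_comb[OF P_ifc_carrier[OF i] v'(1) w'(1)]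
        mult_mat_vec_linear_comb[OF PhiO[of i] mult_mat_vec_carrier[OF R v'(2)]
          mult_mat_vec_carrier[OF R w'(2)]]
        mult_mat_vec_linear_comb[OF PhiG[of i] mult_mat_vec_carrier[OF R v'(2)]
          mult_mat_vec_carrier[OF R w'(2)]]
        mult_mat_vec_linear_comb[OF R v'(2) w'(2)] v'(3,4)[OF i] w'(3,4)[OF i]
      by (simp_all del: Phi_int.simps Phi_ifc.simps)
    then show ?thesis
      using v'(1,2) w'(1,2)
      by (auto intro!: bexI[of _ "c \<cdot>\<^sub>v vn + wn"] simp del: Phi_int.simps Phi_ifc.simps)
  qed
  ultimately show ?thesis
    unfolding linear_subspace_def by auto
qed

end

text \<open>The numbers of rows \<open>mA\<close> and \<open>m\<close> agree as soon as there is a subdomain; if there is none, both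
  sums are empty.\<close>

lemma constraint_eq_zero_cong:
  fixes n :: nat
  assumes "\<And>i. i < n \<Longrightarrow> A i = Abar i"
    and "\<And>i. i < n \<Longrightarrow> A i \<in> carrier_mat mA (k i)"
    and "\<And>i. i < n \<Longrightarrow> Abar i \<in> carrier_mat m (k i)"
  shows "finsum_vec TYPE(real) mA (\<lambda>i. A i *\<^sub>v y i) {..<n} = 0\<^sub>v mA \<longleftrightarrow>
    finsum_vec TYPE(real) m (\<lambda>i. Abar i *\<^sub>v y i) {..<n} = 0\<^sub>v m"
proof (cases "n = 0")
  case True
  then show ?thesis by (simp add: finsum_vec_empty)
next
  case False
  then have [simp]: "mA = m"
    using assms(1)[of 0] assms(2)[of 0] assms(3)[of 0] by auto
  have "finsum_vec TYPE(real) m (\<lambda>i. A i *\<^sub>v y i) {..<n} =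
      finsum_vec TYPE(real) m (\<lambda>i. Abar i *\<^sub>v y i) {..<n}"
    using assms(1) carrier_matD(1)[OF assms(3)] by (intro finsum_vec_cong) (auto intro!: carrier_vecI)
  then show ?thesis by simp
qed

lemma lspg_objective_sub_res:
  assumes "\<And>i. i < n_sub D \<Longrightarrow> P_int D i *\<^sub>v w = u i" "\<And>i. i < n_sub D \<Longrightarrow> P_ifc D i *\<^sub>v w = v i"
  shows "lspg_objective D B u v = 1 / 2 * (\<Sum>i<n_sub D. (norm2 (B i *\<^sub>v sub_res D i w))\<^sup>2)"
  unfolding lspg_objective_def sub_res_def using assms by simp

text \<open>Coordinates and global states determine the same objective, because the restrictions of a state to the
  subdomains are the reconstructions from its coordinates. By the parametrization of the feasible interface
  coordinates, the states reconstructed from feasible coordinates are those in the trial space.\<close>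

lemma global_lspg_solution_minimizes:
  assumes bases: "valid_bases D bs"
    and A: "\<And>i. i < n_sub D \<Longrightarrow> A i = Abar i"
      "\<And>i. i < n_sub D \<Longrightarrow> A i \<in> carrier_mat mA (n_ifc D i)"
    and Abar: "\<And>i. i < n_sub D \<Longrightarrow> Abar i \<in> carrier_mat m (n_ifc D i)"
    and N: "null_basis_mat D m Abar bs N"
    and sol: "global_lspg_solution D B mA A bs xt"
  shows "is_arg_min (\<lambda>w. \<Sum>i<n_sub D. (norm2 (B i *\<^sub>v sub_res D i w))\<^sup>2)
    (\<lambda>w. w \<in> trial_space D bs N) xt"
proof -
  have feas: "(\<forall>i<n_sub D. w i \<in> carrier_vec (p_ifc bs i)) \<and>
      finsum_vec TYPE(real) mA (\<lambda>i. A i *\<^sub>v (Phi_ifc D bs i *\<^sub>v w i)) {..<n_sub D} = 0\<^sub>v mA \<longleftrightarrow>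
    (\<exists>u\<in>carrier_vec (dim_col N). \<forall>i<n_sub D. w i = row_block (p_ifc bs) N i *\<^sub>v u)" for w
    using feasible_iff_null_basis_coords[OF Phi_ifc_carrier[OF bases] Abar N, of w]
    by (simp add: constraint_eq_zero_cong[OF A Abar])
  show ?thesis
  proof (cases bs)
    case [simp]: (Interior_Boundary pO pG PhiO PhiG)
    have [simp]: "p_ifc (Interior_Boundary pO pG PhiO PhiG) = pG"
      "Phi_ifc D (Interior_Boundary pO pG PhiO PhiG) = PhiG" by auto
    obtain xO xG where xt: "xt \<in> carrier_vec (n_dof D)"
        "\<And>i. i < n_sub D \<Longrightarrow> P_int D i *\<^sub>v xt = PhiO i *\<^sub>v xO i"
        "\<And>i. i < n_sub D \<Longrightarrow> P_ifc D i *\<^sub>v xt = PhiG i *\<^sub>v xG i"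
      and opt: "ib_lspg_solution D B mA A pO pG PhiO PhiG xO xG"
      using sol by auto
    have xO: "\<And>i. i < n_sub D \<Longrightarrow> xO i \<in> carrier_vec (pO i)"
      using opt by (auto simp: ib_lspg_solution_def is_arg_min_def)
    obtain u where u: "u \<in> carrier_vec (dim_col N)"
      "\<And>i. i < n_sub D \<Longrightarrow> xG i = row_block pG N i *\<^sub>v u"
      using opt feas[of xG] by (auto simp: ib_lspg_solution_def is_arg_min_def)
    have "xt \<in> trial_space D bs N"
      using xt xO u by auto
    moreover have "(\<Sum>i<n_sub D. (norm2 (B i *\<^sub>v sub_res D i xt))\<^sup>2)
        \<le> (\<Sum>i<n_sub D. (norm2 (B i *\<^sub>v sub_res D i w))\<^sup>2)"
      if wS: "w \<in> trial_space D bs N" for w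
    proof -
      obtain wO wn where wO: "\<And>i. i < n_sub D \<Longrightarrow> wO i \<in> carrier_vec (pO i)"
        and wn: "wn \<in> carrier_vec (dim_col N)"
        and w: "\<And>i. i < n_sub D \<Longrightarrow> P_int D i *\<^sub>v w = PhiO i *\<^sub>v wO i"
          "\<And>i. i < n_sub D \<Longrightarrow> P_ifc D i *\<^sub>v w = PhiG i *\<^sub>v (row_block pG N i *\<^sub>v wn)"
        using wS by auto
      have "\<exists>u\<in>carrier_vec (dim_col N).
          \<forall>i<n_sub D. row_block pG N i *\<^sub>v wn = row_block pG N i *\<^sub>v u"
        using wn by blast
      then have "(\<forall>i<n_sub D. row_block pG N i *\<^sub>v wn \<in> carrier_vec (pG i)) \<and>
          finsum_vec TYPE(real) mA (\<lambda>i. A i *\<^sub>v (PhiG i *\<^sub>v (row_block pG N i *\<^sub>v wn))) {..<n_sub D}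
            = 0\<^sub>v mA"
        using feas[of "\<lambda>i. row_block pG N i *\<^sub>v wn"] by simp
      then have "lspg_objective D B (\<lambda>i. PhiO i *\<^sub>v xO i) (\<lambda>i. PhiG i *\<^sub>v xG i)
          \<le> lspg_objective D B (\<lambda>i. PhiO i *\<^sub>v wO i) (\<lambda>i. PhiG i *\<^sub>v (row_block pG N i *\<^sub>v wn))"
        using opt[unfolded ib_lspg_solution_def is_arg_min_linorder, THEN conjunct2, THEN spec,
            of "(wO, \<lambda>i. row_block pG N i *\<^sub>v wn)"] wO
        by simp
      then show ?thesis
        using lspg_objective_sub_res[of D w, OF w] lspg_objective_sub_res[of D xt, OF xt(2,3)]
        by simp
    qed
    ultimately show ?thesis
      unfolding is_arg_min_linorder by blast
  next
    case [simp]: (Full_Subdomain p Phi)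
    let ?PhiO = "Phi_int D (Full_Subdomain p Phi)" and ?PhiG = "Phi_ifc D (Full_Subdomain p Phi)"
    have [simp]: "p_ifc (Full_Subdomain p Phi) = p" by auto
    obtain xh where xt: "xt \<in> carrier_vec (n_dof D)"
        "\<And>i. i < n_sub D \<Longrightarrow> P_int D i *\<^sub>v xt = ?PhiO i *\<^sub>v xh i"
        "\<And>i. i < n_sub D \<Longrightarrow> P_ifc D i *\<^sub>v xt = ?PhiG i *\<^sub>v xh i"
      and opt: "full_lspg_solution D B mA A p ?PhiO ?PhiG xh"
      using sol by (auto simp: Let_def simp del: Phi_int.simps Phi_ifc.simps)
    obtain u where u: "u \<in> carrier_vec (dim_col N)"
      "\<And>i. i < n_sub D \<Longrightarrow> xh i = row_block p N i *\<^sub>v u"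
      using opt feas[of xh]
      by (auto simp: full_lspg_solution_def is_arg_min_def simp del: Phi_int.simps Phi_ifc.simps)
    have "xt \<in> trial_space D bs N"
      using xt u by (auto simp del: Phi_int.simps Phi_ifc.simps)
    moreover have "(\<Sum>i<n_sub D. (norm2 (B i *\<^sub>v sub_res D i xt))\<^sup>2)
        \<le> (\<Sum>i<n_sub D. (norm2 (B i *\<^sub>v sub_res D i w))\<^sup>2)"
      if wS: "w \<in> trial_space D bs N" for w
    proof -
      obtain wn where wn: "wn \<in> carrier_vec (dim_col N)"
        and w: "\<And>i. i < n_sub D \<Longrightarrow> P_int D i *\<^sub>v w = ?PhiO i *\<^sub>v (row_block p N i *\<^sub>v wn)"
          "\<And>i. i < n_sub D \<Longrightarrow> P_ifc D i *\<^sub>v w = ?PhiG i *\<^sub>v (row_block p N i *\<^sub>v wn)"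
        using wS by (auto simp del: Phi_int.simps Phi_ifc.simps)
      have "\<exists>u\<in>carrier_vec (dim_col N).
          \<forall>i<n_sub D. row_block p N i *\<^sub>v wn = row_block p N i *\<^sub>v u"
        using wn by blast
      then have "(\<forall>i<n_sub D. row_block p N i *\<^sub>v wn \<in> carrier_vec (p i)) \<and>
          finsum_vec TYPE(real) mA (\<lambda>i. A i *\<^sub>v (?PhiG i *\<^sub>v (row_block p N i *\<^sub>v wn))) {..<n_sub D}
            = 0\<^sub>v mA"
        using feas[of "\<lambda>i. row_block p N i *\<^sub>v wn"] by (simp del: Phi_int.simps Phi_ifc.simps)
      then have "lspg_objective D B (\<lambda>i. ?PhiO i *\<^sub>v xh i) (\<lambda>i. ?PhiG i *\<^sub>v xh i)
          \<le> lspg_objective D B (\<lambda>i. ?PhiO i *\<^sub>v (row_block p N i *\<^sub>v wn))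
            (\<lambda>i. ?PhiG i *\<^sub>v (row_block p N i *\<^sub>v wn))"
        using opt[unfolded full_lspg_solution_def is_arg_min_linorder, THEN conjunct2, THEN spec,
            of "\<lambda>i. row_block p N i *\<^sub>v wn"]
        by (simp del: Phi_int.simps Phi_ifc.simps)
      then show ?thesis
        using lspg_objective_sub_res[of D w, OF w] lspg_objective_sub_res[of D xt, OF xt(2,3)]
        by (simp del: Phi_int.simps Phi_ifc.simps)
    qed
    ultimately show ?thesis
      unfolding is_arg_min_linorder by blast
  qed
qed

text \<open>It suffices to bound the error by the distance of \<open>x\<close> to an arbitrary \<open>w\<close> in the trial space; a
  nearest point is one choice of \<open>w\<close>.\<close>

theorem proposition2:
  fixes D :: dd_system
    and bs :: rom_bases
    and m mA :: nat and nB :: "nat \<Rightarrow> nat"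
    and Abar A B :: "nat \<Rightarrow> real mat" and N :: "real mat"
    and kl ku P :: real
    and x xt :: "real vec"
  assumes "decomposed_system D"
    and "strong_constraints D m Abar"
    and "valid_bases D bs"
    and "\<forall>i<n_sub D. B i \<in> carrier_mat (nB i) (n_res D i) \<and> nB i \<le> n_res D i"
    and "\<forall>i<n_sub D. A i \<in> carrier_mat mA (n_ifc D i)"
    and "null_basis_mat D m Abar bs N"
    and A1: "\<forall>i<n_sub D. A i = Abar i"
    and A2: "kl > 0"
      "\<forall>w\<in>carrier_vec (n_dof D). \<forall>y\<in>carrier_vec (n_dof D).
         sqrt (\<Sum>i<n_sub D. (norm2 (sub_res D i w - sub_res D i y))\<^sup>2) \<ge> kl * norm2 (w - y)"
    and A3: "P > 0"
      "\<forall>w\<in>trial_space D bs N.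
         sqrt (\<Sum>i<n_sub D. (norm2 (B i *\<^sub>v sub_res D i w))\<^sup>2)
           \<ge> P * sqrt (\<Sum>i<n_sub D. (norm2 (sub_res D i w))\<^sup>2)"
    and A4: "ku > 0"
      "\<forall>w\<in>carrier_vec (n_dof D). \<forall>y\<in>carrier_vec (n_dof D).
         sqrt (\<Sum>i<n_sub D. (norm2 (B i *\<^sub>v sub_res D i w - B i *\<^sub>v sub_res D i y))\<^sup>2)
           \<le> ku * norm2 (w - y)"
    and "x \<in> carrier_vec (n_dof D)" and "r_glob D x = 0\<^sub>v (n_dof D)"
    and "global_lspg_solution D B mA A bs xt"
  shows "\<exists>ws. is_arg_min (\<lambda>w. norm2 (x - w)) (\<lambda>w. w \<in> trial_space D bs N) ws \<and>
           norm2 (x - xt) \<le> ku / (P * kl) * norm2 (x - ws)"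
proof -
  interpret decomposed_system D by fact
  let ?S = "trial_space D bs N"
  have Abar: "Abar i \<in> carrier_mat m (n_ifc D i)" if "i < n_sub D" for i
    using assms(2) that by (simp add: strong_constraints_def)
  have "is_arg_min (\<lambda>w. \<Sum>i<n_sub D. (norm2 (B i *\<^sub>v sub_res D i w))\<^sup>2) (\<lambda>w. w \<in> ?S) xt"
    using assms(3,5,6) A1 assms(16) by (intro global_lspg_solution_minimizes[where A = A]) (auto intro: Abar)
  then have xt: "xt \<in> ?S"
    and opt: "\<And>w. w \<in> ?S \<Longrightarrow> (\<Sum>i<n_sub D. (norm2 (B i *\<^sub>v sub_res D i xt))\<^sup>2)
      \<le> (\<Sum>i<n_sub D. (norm2 (B i *\<^sub>v sub_res D i w))\<^sup>2)"
    by (auto simp: is_arg_min_def not_less)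
  have S: "linear_subspace (n_dof D) ?S"
    using assms(3) by (rule linear_subspace_trial_space)
  note x = \<open>x \<in> carrier_vec (n_dof D)\<close>
  have zero: "sub_res D i x = 0\<^sub>v (n_res D i)" if "i < n_sub D" for i
    using sub_res_eq_zero[OF that x] \<open>r_glob D x = 0\<^sub>v (n_dof D)\<close> .
  have carr: "w \<in> carrier_vec (n_dof D)" if "w \<in> ?S" for w
    using S that by (auto simp: linear_subspace_def)
  have minus_zero: "sub_res D i w - sub_res D i x = sub_res D i w"
    "B i *\<^sub>v sub_res D i w - B i *\<^sub>v sub_res D i x = B i *\<^sub>v sub_res D i w"
    if "i < n_sub D" "w \<in> ?S" for i w
  proof -
    have "B i \<in> carrier_mat (nB i) (n_res D i)"
      using assms(4) that(1) by auto
    then have "B i *\<^sub>v sub_res D i x = 0\<^sub>v (nB i)" "B i *\<^sub>v sub_res D i w \<in> carrier_vec (nB i)"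
      using zero[OF that(1)] mult_mat_zero_vec sub_res_carrier[OF that(1) carr[OF that(2)]] by auto
    then show "sub_res D i w - sub_res D i x = sub_res D i w"
      "B i *\<^sub>v sub_res D i w - B i *\<^sub>v sub_res D i x = B i *\<^sub>v sub_res D i w"
      using sub_res_carrier[OF that(1) carr[OF that(2)]] zero[OF that(1)] by auto
  qed
  have bound: "norm2 (x - xt) \<le> ku / (P * kl) * norm2 (x - w)" if w: "w \<in> ?S" for w
  proof -
    \<comment> \<open>Stability of \<open>R\<close>, stability of \<open>B\<close> on the trial space, optimality, Lipschitz continuity of \<open>BR\<close>.\<close>
    have "P * (kl * norm2 (xt - x)) \<le>
        P * sqrt (\<Sum>i<n_sub D. (norm2 (sub_res D i xt - sub_res D i x))\<^sup>2)"
      using A2(2) A3(1) carr[OF xt] x by (intro mult_left_mono) auto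
    also have "\<dots> = P * sqrt (\<Sum>i<n_sub D. (norm2 (sub_res D i xt))\<^sup>2)"
      using minus_zero xt by simp
    also have "\<dots> \<le> sqrt (\<Sum>i<n_sub D. (norm2 (B i *\<^sub>v sub_res D i xt))\<^sup>2)"
      using A3(2) xt by simp
    also have "\<dots> \<le> sqrt (\<Sum>i<n_sub D. (norm2 (B i *\<^sub>v sub_res D i w))\<^sup>2)"
      using opt[OF w] by simp
    also have "\<dots> = sqrt (\<Sum>i<n_sub D. (norm2 (B i *\<^sub>v sub_res D i w - B i *\<^sub>v sub_res D i x))\<^sup>2)"
      using minus_zero w by simp
    also have "\<dots> \<le> ku * norm2 (w - x)"
      using A4(2) carr[OF w] x by simp
    finally show ?thesis
      using A2(1) A3(1) norm2_minus_commute[OF x carr[OF xt]] norm2_minus_commute[OF x carr[OF w]]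
      by (simp add: field_simps)
  qed
  obtain ws where ws: "is_arg_min (\<lambda>w. norm2 (x - w)) (\<lambda>w. w \<in> ?S) ws"
    using ex_nearest_point[OF S x] .
  then show ?thesis
    using bound by (auto simp: is_arg_min_def)
qed

end
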